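(* Let $k\ge -\tfrac12$ and $M=(a,b;c,d)\in SL(2,\mathbb{R})$ with $b\ne 0$. Let $1<p\le 2$, let $q$ be the conjugate exponent of $p$, let $0<\alpha<\frac{2(k+1)}{q}$ and $\beta>0$. Then there exists a constant $C>0$ (independent of $f$) such that for every $f\in L^p_k(\mathbb{R})$, $$\|D_k^M(f)\|_{L^{q}_k(\mathbb{R})} \le C\, \big\||y|^\alpha f\big\|^{\frac{\beta}{\alpha+\beta}}_{L_k^p(\mathbb{R})}\, \big\||\lambda|^\beta D_k^M(f)\big\|^{\frac{\alpha}{\alpha+\beta}}_{L_k^{q}(\mathbb{R})},$$ where the norms on the right-hand side are allowed to be $+\infty$.
   Context: For $k\ge-\frac12$ let $d\mu_k(x)=\frac{|x|^{2k+1}}{2^{k+1}\Gamma(k+1)}\,dx$ on $\mathbb{R}$, and let $L^p_k(\mathbb{R})=L^p(\mathbb{R},\mu_k)$ (complex-valued functions) with its usual norm, $1\le p\le\infty$. The Dunkl kernel is $E_k(-i\lambda,x)=j_k(\lambda x)-\frac{i\lambda x}{2(k+1)}j_{k+1}(\lambda x)$, where $j_k(u)=\Gamma(k+1)\sum_{n\ge0}\frac{(-1)^n(u/2)^{2n}}{n!\,\Gamma(n+k+1)}$. For $M=(a,b;c,d)$, meaning the matrix $\begin{bmatrix}a&b\\c&d\end{bmatrix}\in SL(2,\mathbb{R})$, with $b\neq0$, the linear canonical Dunkl transform of $f\in L^1_k(\mathbb{R})$ is $$D_k^M(f)(\lambda)=\frac{1}{(ib)^{k+1}}\int_{\mathbb{R}}f(x)\,e^{\frac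 i2\left(\frac db\lambda^2+\frac ab x^2\right)}E_k(-i\lambda/b,x)\,d\mu_k(x),$$ with $(ib)^{k+1}$ the principal branch. For $1<p\le2$ with conjugate exponent $q$, $D_k^M$ on $L^p_k(\mathbb{R})$ denotes the unique bounded extension $L^p_k(\mathbb{R})\to L^q_k(\mathbb{R})$ of this integral transform from $L^1_k(\mathbb{R})\cap L^p_k(\mathbb{R})$. *)

theory Defs
  imports "HOL-Analysis.Analysis"
begin

text \<open>At the points where a base is zero, \<open>powr\<close> gives zero; in the weights below this
  concerns at most the null set \<open>{0}\<close>.\<close>

definition dunkl_measure :: "real \<Rightarrow> real measure" where
  "dunkl_measure k =
     density lborel (\<lambda>x. ennreal (\<bar>x\<bar> powr (2 * k + 1) / (2 powr (k + 1) * Gamma (k + 1))))"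

text \<open>Powers of extended nonnegative reals, only meant for exponents \<open>r > 0\<close>.\<close>

definition epowr :: "ennreal \<Rightarrow> real \<Rightarrow> ennreal" where
  "epowr x r = (if x = top then top else ennreal (enn2real x powr r))"

definition Lp_norm :: "real \<Rightarrow> real \<Rightarrow> (real \<Rightarrow> complex) \<Rightarrow> ennreal" where
  "Lp_norm k p f = epowr (\<integral>\<^sup>+ x. ennreal (cmod (f x) powr p) \<partial>dunkl_measure k) (1 / p)"

text \<open>Elements are functions, not classes modulo almost everywhere equality.\<close>

definition Lp_space :: "real \<Rightarrow> real \<Rightarrow> (real \<Rightarrow> complex) set" where
  "Lp_space k p = {f \<in> borel_measurable (dunkl_measure k). Lp_norm k p f < top}"

definition bessel_j :: "real \<Rightarrow> real \<Rightarrow> real" where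
  "bessel_j k u =
     Gamma (k + 1) * (\<Sum>n. (- 1) ^ n * (u / 2) ^ (2 * n) / (fact n * Gamma (real n + k + 1)))"

text \<open>\<open>dunkl_kernel k l x\<close> stands for \<open>E\<^sub>k(-i l, x)\<close>; the factor \<open>-i\<close> is built in.\<close>

definition dunkl_kernel :: "real \<Rightarrow> real \<Rightarrow> real \<Rightarrow> complex" where
  "dunkl_kernel k l x =
     of_real (bessel_j k (l * x))
       - \<i> * of_real (l * x) / of_real (2 * (k + 1)) * of_real (bessel_j (k + 1) (l * x))"

definition lc_dunkl :: "real \<Rightarrow> real^2^2 \<Rightarrow> (real \<Rightarrow> complex) \<Rightarrow> real \<Rightarrow> complex" where
  "lc_dunkl k M f l =
     (let a = M $ 1 $ 1; b = M $ 1 $ 2; d = M $ 2 $ 2 in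
      1 / (\<i> * of_real b) powr of_real (k + 1) *
      (LINT x|dunkl_measure k.
         f x * exp (\<i> / 2 * of_real (d / b * l\<^sup>2 + a / b * x\<^sup>2)) * dunkl_kernel k (l / b) x))"

text \<open>\<open>T\<close> is the bounded linear extension of \<open>lc_dunkl k M\<close> from the intersection of the
  \<open>L\<^sup>1\<close> and \<open>L\<^sup>p\<close> spaces to an operator from \<open>L\<^sup>p\<close> to \<open>L\<^sup>q\<close>, expressed on
  representatives. Since the intersection is dense in \<open>L\<^sup>p\<close>, this determines \<open>T f\<close>
  up to almost everywhere equality; for \<open>1 < p \<le> 2\<close> and conjugate \<open>q\<close> such a \<open>T\<close>
  exists by the Hausdorff-Young inequality.\<close>

definition is_lc_dunkl_extension ::
  "real \<Rightarrow> real^2^2 \<Rightarrow> real \<Rightarrow> real \<Rightarrow> ((real \<Rightarrow> complex) \<Rightarrow> (real \<Rightarrow> complex)) \<Rightarrow> bool" where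
  "is_lc_dunkl_extension k M p q T \<longleftrightarrow>
     (\<forall>f\<in>Lp_space k p. T f \<in> Lp_space k q) \<and>
     (\<forall>f\<in>Lp_space k p. \<forall>g\<in>Lp_space k p.
        AE l in dunkl_measure k. T (\<lambda>x. f x + g x) l = T f l + T g l) \<and>
     (\<forall>c. \<forall>f\<in>Lp_space k p. AE l in dunkl_measure k. T (\<lambda>x. c * f x) l = c * T f l) \<and>
     (\<exists>B. \<forall>f\<in>Lp_space k p. Lp_norm k q (T f) \<le> ennreal B * Lp_norm k p f) \<and>
     (\<forall>f\<in>Lp_space k 1 \<inter> Lp_space k p. AE l in dunkl_measure k. T f l = lc_dunkl k M f l)"

end

theory Submission
  imports Defs
begin

text \<open>
  Split \<open>f\<close> at radius \<open>1/s\<close>. On the inner part, Hoelder's inequality against the weight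
  \<open>|x|\<^sup>-\<^sup>\<alpha>\<close> (integrable to the power \<open>q\<close> near the origin because
  \<open>\<alpha> q < 2(k + 1)\<close>) bounds the \<open>L\<^sup>1\<close> norm, hence the supremum of its transform, since the
  Dunkl kernel is bounded by one; the outer part is controlled by the boundedness of \<open>D\<close>. Both
  contribute a multiple of \<open>s\<^sup>\<alpha>\<close> times the weighted norm of \<open>f\<close> on \<open>|\<lambda>| \<le> s\<close>, while on
  \<open>|\<lambda>| > s\<close> the weight \<open>|\<lambda>|\<^sup>\<beta>\<close> gains \<open>s\<^sup>-\<^sup>\<beta>\<close>; then \<open>s\<close> is chosen to balance the two.

  The bound on the kernel is an energy estimate: \<open>|E\<^sub>k|\<^sup>2 = j\<^sub>k\<^sup>2 + j\<^sub>k'\<^sup>2\<close> is nonincreasing on the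
  positive half-line by the Bessel equation.
\<close>

section \<open>Bessel power series and the bound on the Dunkl kernel\<close>

text \<open>\<open>clifford k\<close> is the normalised Bessel function in the variable \<open>u\<^sup>2/4\<close>, divided by
  \<open>Gamma (k + 1)\<close>; in this variable differentiation is just the shift \<open>k \<mapsto> k + 1\<close>.\<close>

definition clifford_coeff :: "real \<Rightarrow> nat \<Rightarrow> real" where
  "clifford_coeff k n = (- 1) ^ n / (fact n * Gamma (real n + k + 1))"

definition clifford :: "real \<Rightarrow> real \<Rightarrow> real" where
  "clifford k x = (\<Sum>n. clifford_coeff k n * x ^ n)"

text \<open>Raising the argument by one multiplies Gamma by \<open>real n + k + 1\<close>, which is
  at least \<open>k + 1\<close>. This growth supplies an exponential majorant for the series
  below.\<close>

lemma Gamma_ge_power: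
  assumes "k > -1"
  shows "Gamma (k + 1) * (k + 1) ^ n \<le> Gamma (real n + k + 1)"
proof (induction n)
  case (Suc n)
  have "Gamma (k + 1) * (k + 1) ^ Suc n \<le> (real n + k + 1) * Gamma (real n + k + 1)"
    using mult_mono[OF _ Suc, of "k + 1" "real n + k + 1"] assms
    by (simp add: mult_ac less_imp_le)
  also have "\<dots> = Gamma (real (Suc n) + k + 1)"
    using Gamma_plus1[of "real n + k + 1"] assms
    by (simp add: add_ac nonpos_Ints_def)
  finally show ?case .
qed simp

text \<open>By \<open>Gamma_ge_power\<close> the terms are dominated, up to the factor
  \<open>inverse (Gamma (k + 1))\<close>, by those of the exponential series at
  \<open>\<bar>x\<bar> / (k + 1)\<close>.\<close>

lemma summable_clifford:
  assumes "k > -1"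
  shows "summable (\<lambda>n. clifford_coeff k n * x ^ n)"
proof (rule summable_comparison_test')
  show "summable (\<lambda>n. inverse (Gamma (k + 1)) * (inverse (fact n) * (\<bar>x\<bar> / (k + 1)) ^ n))"
    by (intro summable_mult summable_exp)
  fix n
  have G: "Gamma (k + 1) > 0" using assms by simp
  have "Gamma (k + 1) * (k + 1) ^ n > 0" using assms by simp
  then have "inverse (Gamma (real n + k + 1)) \<le> inverse (Gamma (k + 1) * (k + 1) ^ n)"
    by (intro le_imp_inverse_le Gamma_ge_power assms)
  then have "\<bar>x\<bar> ^ n * inverse (fact n) * inverse (Gamma (real n + k + 1))
      \<le> \<bar>x\<bar> ^ n * inverse (fact n) * inverse (Gamma (k + 1) * (k + 1) ^ n)"
    by (intro mult_left_mono) auto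
  moreover have "norm (clifford_coeff k n * x ^ n)
      = \<bar>x\<bar> ^ n * inverse (fact n) * inverse (Gamma (real n + k + 1))"
    using assms by (simp add: clifford_coeff_def abs_mult power_abs field_simps)
  moreover have "\<bar>x\<bar> ^ n * inverse (fact n) * inverse (Gamma (k + 1) * (k + 1) ^ n)
      = inverse (Gamma (k + 1)) * (inverse (fact n) * (\<bar>x\<bar> / (k + 1)) ^ n)"
    by (simp add: power_mult_distrib power_inverse divide_inverse mult_ac)
  ultimately show "norm (clifford_coeff k n * x ^ n)
      \<le> inverse (Gamma (k + 1)) * (inverse (fact n) * (\<bar>x\<bar> / (k + 1)) ^ n)"
    by metis
qed

lemma has_real_derivative_clifford:
  assumes "k > -1"
  shows "(clifford k has_real_derivative - clifford (k + 1) x) (at x)"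
proof -
  have "diffs (clifford_coeff k) = (\<lambda>n. - clifford_coeff (k + 1) n)"
  proof
    fix n
    show "diffs (clifford_coeff k) n = - clifford_coeff (k + 1) n"
      \<comment> \<open>\<open>real (Suc n)\<close> is kept whole at first, so that it cancels
        against the same factor of \<open>fact (Suc n)\<close>.\<close>
      by (simp add: diffs_def clifford_coeff_def algebra_simps del: of_nat_Suc)
        (simp add: algebra_simps)
  qed
  moreover have "summable (\<lambda>n. clifford_coeff (k + 1) n * x ^ n)"
    using assms by (intro summable_clifford) auto
  ultimately show ?thesis
    using termdiffs_strong_converges_everywhere[OF summable_clifford[OF assms], of x]
    by (simp add: clifford_def[abs_def] suminf_minus)
qed

text \<open>Since differentiation is a shift with a sign, this is Bessel's equation
  \<open>x * y'' + (k + 1) * y' + y = 0\<close> for \<open>y = clifford k\<close>. It is proved by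
  comparing coefficients.\<close>

lemma clifford_recurrence:
  assumes "k > -1"
  shows "x * clifford (k + 2) x = (k + 1) * clifford (k + 1) x - clifford k x"
proof -
  let ?h = "\<lambda>n. (k + 1) * (clifford_coeff (k + 1) n * x ^ n) - clifford_coeff k n * x ^ n"
  have S: "summable (\<lambda>n. clifford_coeff (k + 1) n * x ^ n)"
      "summable (\<lambda>n. clifford_coeff k n * x ^ n)"
    using assms by (intro summable_clifford; simp)+
  have "?h sums ((k + 1) * clifford (k + 1) x - clifford k x)"
    using S unfolding clifford_def by (intro sums_diff sums_mult summable_sums)
  \<comment> \<open>The constant terms cancel by the functional equation of Gamma, so the series
    starts at index 1 and a factor \<open>x\<close> can be taken out.\<close>
  moreover have "?h 0 = 0"
    using assms Gamma_plus1[of "k + 1"] by (simp add: clifford_coeff_def nonpos_Ints_def)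
  ultimately have "(\<lambda>n. ?h (Suc n)) sums ((k + 1) * clifford (k + 1) x - clifford k x)"
    using sums_Suc_iff[of ?h "(k + 1) * clifford (k + 1) x - clifford k x"] by simp
  moreover have "?h (Suc n) = x * (clifford_coeff (k + 2) n * x ^ n)" for n
  proof -
    define G where "G = Gamma (real n + k + 2)"
    have "G > 0" unfolding G_def using assms by simp
    moreover have "Gamma (real n + k + 3) = (real n + k + 2) * G"
      using Gamma_plus1[of "real n + k + 2"] assms unfolding G_def
      by (simp add: add_ac nonpos_Ints_def)
    moreover have "real (Suc n) + (k + 1) + 1 = real n + k + 3"
      "real (Suc n) + k + 1 = real n + k + 2" "real n + (k + 2) + 1 = real n + k + 3" by simp_all
    ultimately have coeff: "(k + 1) * clifford_coeff (k + 1) (Suc n) - clifford_coeff k (Suc n)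
        = clifford_coeff (k + 2) n"
      using assms by (simp only: clifford_coeff_def G_def[symmetric])
         (simp add: divide_simps, simp add: algebra_simps)
    have "?h (Suc n) = ((k + 1) * clifford_coeff (k + 1) (Suc n) - clifford_coeff k (Suc n)) * x ^ Suc n"
      by (simp only: left_diff_distrib mult.assoc)
    then show ?thesis unfolding coeff by simp
  qed
  ultimately have "(\<lambda>n. x * (clifford_coeff (k + 2) n * x ^ n)) sums
      ((k + 1) * clifford (k + 1) x - clifford k x)" by simp
  moreover have "(\<lambda>n. x * (clifford_coeff (k + 2) n * x ^ n)) sums (x * clifford (k + 2) x)"
    unfolding clifford_def using assms by (intro sums_mult summable_sums summable_clifford) auto
  ultimately show ?thesis using sums_unique2 by blast
qed

text \<open>The recurrence turns the derivative of the left-hand side into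
  \<open>-(2k + 1) (clifford (k + 1) x)\<^sup>2\<close>, whose sign is where \<open>k \<ge> -1/2\<close> enters.\<close>

lemma clifford_energy_le:
  assumes "k \<ge> - 1 / 2" and "x \<ge> 0"
  shows "(clifford k x)\<^sup>2 + x * (clifford (k + 1) x)\<^sup>2 \<le> (inverse (Gamma (k + 1)))\<^sup>2"
proof -
  let ?G = "\<lambda>x. (clifford k x)\<^sup>2 + x * (clifford (k + 1) x)\<^sup>2"
  have "(?G has_real_derivative - (2 * k + 1) * (clifford (k + 1) y)\<^sup>2) (at y)" for y
  proof -
    have "(?G has_real_derivative 2 * clifford k y * - clifford (k + 1) y +
       (clifford (k + 1) y)\<^sup>2 + 2 * clifford (k + 1) y * - (y * clifford (k + 2) y)) (at y)"
      using assms
      by (auto intro!: derivative_eq_intros has_real_derivative_clifford[THEN DERIV_cong]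
          simp: add.assoc mult_ac)
    then show ?thesis
      by (rule DERIV_cong)
        (use assms in \<open>simp add: clifford_recurrence power2_eq_square algebra_simps\<close>)
  qed
  then have "?G x \<le> ?G 0"
    using assms by (intro DERIV_nonpos_imp_nonincreasing[OF assms(2)]) (force intro: mult_nonpos_nonneg)
  also have "?G 0 = (inverse (Gamma (k + 1)))\<^sup>2"
    unfolding clifford_def powser_zero by (simp add: clifford_coeff_def inverse_eq_divide)
  finally show ?thesis .
qed

lemma bessel_j_eq_clifford:
  "bessel_j k u = Gamma (k + 1) * clifford k ((u / 2)\<^sup>2)"
  by (simp add: bessel_j_def clifford_def clifford_coeff_def power_mult)

text \<open>With \<open>u = l * x\<close>, the real and imaginary parts are, up to sign,
  \<open>Gamma (k + 1)\<close> times \<open>clifford k\<close> and \<open>u / 2\<close> times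
  \<open>clifford (k + 1)\<close>, both at \<open>(u / 2)\<^sup>2\<close>: the factor
  \<open>k + 1\<close> of \<open>Gamma (k + 2)\<close> cancels the denominator of the kernel. The
  squared modulus is therefore the energy already bounded.\<close>

lemma norm_dunkl_kernel_le_1:
  assumes "k \<ge> - 1 / 2"
  shows "cmod (dunkl_kernel k l x) \<le> 1"
proof -
  define u where "u = l * x"
  have G: "Gamma (k + 2) = (k + 1) * Gamma (k + 1)" "Gamma (k + 1) > 0"
    using Gamma_plus1[of "k + 1"] assms by (auto simp: nonpos_Ints_def add_ac)
  have "dunkl_kernel k l x =
      Complex (bessel_j k u) (- (u / (2 * (k + 1)) * bessel_j (k + 1) u))"
    by (simp add: dunkl_kernel_def u_def complex_eq_iff)
  also have "\<dots> = Complex (Gamma (k + 1) * clifford k ((u / 2)\<^sup>2))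
      (- (Gamma (k + 1) * (u / 2) * clifford (k + 1) ((u / 2)\<^sup>2)))"
  proof -
    have "u / (2 * (k + 1)) * bessel_j (k + 1) u
        = u / (2 * (k + 1)) * ((k + 1) * Gamma (k + 1)) * clifford (k + 1) ((u / 2)\<^sup>2)"
      using G by (simp add: bessel_j_eq_clifford add.assoc)
    then show ?thesis using assms by (simp add: bessel_j_eq_clifford field_simps)
  qed
  finally have "(cmod (dunkl_kernel k l x))\<^sup>2 = (Gamma (k + 1))\<^sup>2 *
      ((clifford k ((u / 2)\<^sup>2))\<^sup>2 + (u / 2)\<^sup>2 * (clifford (k + 1) ((u / 2)\<^sup>2))\<^sup>2)"
    by (simp only: cmod_power2 complex.sel) (simp add: power2_eq_square algebra_simps)
  also have "\<dots> \<le> (Gamma (k + 1))\<^sup>2 * (inverse (Gamma (k + 1)))\<^sup>2"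
    using assms by (intro mult_left_mono clifford_energy_le) auto
  also have "\<dots> = 1\<^sup>2" using G by (simp add: field_simps)
  finally show ?thesis by (rule power2_le_imp_le) simp
qed

section \<open>Norm bounds as integral bounds, and Hoelder's inequality\<close>

lemma epowr_ennreal: "x \<ge> 0 \<Longrightarrow> epowr (ennreal x) r = ennreal (x powr r)"
  by (simp add: epowr_def)

text \<open>Trades a bound on the norm for one on the integral, so that later estimates avoid roots
  of extended reals. If the integral is infinite, both sides are false.\<close>

lemma Lp_norm_le_iff:
  assumes "p > 0" "a \<ge> 0"
  shows "Lp_norm k p f \<le> ennreal a \<longleftrightarrow>
    (\<integral>\<^sup>+ x. ennreal (cmod (f x) powr p) \<partial>dunkl_measure k) \<le> ennreal (a powr p)"
proof (cases "\<integral>\<^sup>+ x. ennreal (cmod (f x) powr p) \<partial>dunkl_measure k")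
  case (real n)
  have "n powr (1 / p) \<le> a \<longleftrightarrow> n \<le> a powr p"
  proof
    assume "n powr (1 / p) \<le> a"
    then have "(n powr (1 / p)) powr p \<le> a powr p" using assms by (intro powr_mono2) auto
    then show "n \<le> a powr p" using assms real by (simp add: powr_powr)
  next
    assume "n \<le> a powr p"
    then have "n powr (1 / p) \<le> (a powr p) powr (1 / p)"
      using assms real by (intro powr_mono2) auto
    then show "n powr (1 / p) \<le> a" using assms by (simp add: powr_powr)
  qed
  then show ?thesis using assms real by (simp add: Lp_norm_def epowr_ennreal)
qed (simp add: Lp_norm_def epowr_def top_unique)

lemma Lp_norm_eq_0_iff:
  assumes "p > 0" "f \<in> borel_measurable (dunkl_measure k)"
  shows "Lp_norm k p f = 0 \<longleftrightarrow> (AE x in dunkl_measure k. f x = 0)"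
proof -
  have [measurable]: "f \<in> borel_measurable (dunkl_measure k)" by fact
  have "Lp_norm k p f = 0 \<longleftrightarrow> (\<integral>\<^sup>+ x. ennreal (cmod (f x) powr p) \<partial>dunkl_measure k) = 0"
    using Lp_norm_le_iff[of p 0 k f] assms by simp
  also have "\<dots> \<longleftrightarrow> (AE x in dunkl_measure k. ennreal (cmod (f x) powr p) = 0)"
    by (rule nn_integral_0_iff_AE) measurable
  also have "\<dots> \<longleftrightarrow> (AE x in dunkl_measure k. f x = 0)"
    by (intro AE_cong) (simp add: ennreal_eq_0_iff powr_nonneg_iff)
  finally show ?thesis .
qed

lemma conjugate_exponent_gt_1:
  fixes p q :: real
  assumes "p > 1" "1 / p + 1 / q = 1"
  shows "q > 1"
proof -
  have "1 / q = 1 - 1 / p" using assms by simp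
  moreover have "1 / p > 0" "1 / p < 1" using assms by auto
  ultimately have "1 / q > 0" "1 / q < 1" by linarith+
  then show ?thesis by (simp add: divide_less_eq_1)
qed

text \<open>Young's inequality for \<open>u x / U\<close> and \<open>v x / V\<close>, integrated.
  Positive upper bounds \<open>U\<close> and \<open>V\<close> in place of the norms avoid a separate
  treatment of zero or infinite norms.\<close>

lemma nn_integral_Holder:
  fixes u v :: "'a \<Rightarrow> real"
  assumes "p > 1" "1 / p + 1 / q = 1" "U > 0" "V > 0"
    and [measurable]: "u \<in> borel_measurable M" "v \<in> borel_measurable M"
    and nonneg: "\<And>x. u x \<ge> 0" "\<And>x. v x \<ge> 0"
    and u: "(\<integral>\<^sup>+ x. ennreal (u x powr p) \<partial>M) \<le> ennreal (U powr p)"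
    and v: "(\<integral>\<^sup>+ x. ennreal (v x powr q) \<partial>M) \<le> ennreal (V powr q)"
  shows "(\<integral>\<^sup>+ x. ennreal (u x * v x) \<partial>M) \<le> ennreal (U * V)"
proof -
  have "q > 1" by (rule conjugate_exponent_gt_1[OF assms(1,2)])
  note assms = assms this
  \<comment> \<open>The coefficients that Young's inequality acquires on multiplication by
    \<open>U * V\<close>; after integration they contribute \<open>U * V / p\<close> and
    \<open>U * V / q\<close>.\<close>
  define cu cv where "cu = U * V / (p * U powr p)" and "cv = U * V / (q * V powr q)"
  have c: "cu \<ge> 0" "cv \<ge> 0" unfolding cu_def cv_def using assms by auto
  have "u x * v x \<le> cu * u x powr p + cv * v x powr q" for x
  proof -
    have "(u x / U) * (v x / V) \<le> (u x / U) powr p / p + (v x / V) powr q / q"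
      using assms by (intro Youngs_inequality) auto
    then have "U * V * ((u x / U) * (v x / V))
        \<le> U * V * ((u x / U) powr p / p + (v x / V) powr q / q)"
      using assms by (intro mult_left_mono) auto
    moreover have "U * V * ((u x / U) * (v x / V)) = u x * v x"
      using assms by simp
    moreover have "U * V * ((u x / U) powr p / p + (v x / V) powr q / q)
        = cu * u x powr p + cv * v x powr q"
      using assms nonneg by (simp add: powr_divide cu_def cv_def algebra_simps)
    ultimately show ?thesis by simp
  qed
  then have "(\<integral>\<^sup>+ x. ennreal (u x * v x) \<partial>M)
      \<le> (\<integral>\<^sup>+ x. ennreal cu * ennreal (u x powr p) + ennreal cv * ennreal (v x powr q) \<partial>M)"
    using c by (intro nn_integral_mono) (simp add: ennreal_mult[symmetric] ennreal_plus[symmetric] del: ennreal_plus)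
  also have "\<dots> = ennreal cu * (\<integral>\<^sup>+ x. ennreal (u x powr p) \<partial>M)
      + ennreal cv * (\<integral>\<^sup>+ x. ennreal (v x powr q) \<partial>M)"
    by (simp add: nn_integral_add nn_integral_cmult)
  also have "\<dots> \<le> ennreal cu * ennreal (U powr p) + ennreal cv * ennreal (V powr q)"
    by (intro add_mono mult_left_mono u v) auto
  also have "\<dots> = ennreal (cu * U powr p + cv * V powr q)"
    using c by (simp add: ennreal_mult[symmetric] ennreal_plus[symmetric] del: ennreal_plus)
  also have "cu * U powr p + cv * V powr q = U * V * (1 / p + 1 / q)"
    using assms by (simp add: cu_def cv_def field_simps)
  finally show ?thesis using assms by simp
qed

section \<open>Power weights under the Dunkl measure\<close>

lemma has_integral_abs_powr:
  fixes \<gamma> r :: real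
  assumes "\<gamma> > -1" "r \<ge> 0"
  shows "((\<lambda>x. \<bar>x\<bar> powr \<gamma>) has_integral (2 * r powr (\<gamma> + 1) / (\<gamma> + 1))) {-r..r}"
proof -
  have "((\<lambda>x. x powr \<gamma>) has_integral (r powr (\<gamma> + 1) / (\<gamma> + 1))) {0..r}"
    by (rule has_integral_powr_from_0[OF assms])
  then have pos: "((\<lambda>x. \<bar>x\<bar> powr \<gamma>) has_integral (r powr (\<gamma> + 1) / (\<gamma> + 1))) {0..r}"
    by (rule has_integral_eq[rotated]) auto
  then have "((\<lambda>x. \<bar>x\<bar> powr \<gamma>) has_integral (r powr (\<gamma> + 1) / (\<gamma> + 1))) {-r..0}"
    using has_integral_reflect_real[where a = 0 and b = r and f = "\<lambda>x. \<bar>x\<bar> powr \<gamma>"] by simp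
  from has_integral_combine[of "-r" 0 r, OF _ _ this pos] show ?thesis
    using assms by (simp add: add_divide_distrib[symmetric])
qed

definition dunkl_const :: "real \<Rightarrow> real" where
  "dunkl_const k = 2 powr (k + 1) * Gamma (k + 1)"

lemma dunkl_const_pos: "k > -1 \<Longrightarrow> dunkl_const k > 0"
  by (simp add: dunkl_const_def)

lemma sets_dunkl_measure [measurable_cong, simp]: "sets (dunkl_measure k) = sets borel"
  by (simp add: dunkl_measure_def)

lemma space_dunkl_measure [simp]: "space (dunkl_measure k) = UNIV"
  by (simp add: dunkl_measure_def)

text \<open>Discards the one point where \<open>powr\<close> falls back to zero, so that power
  weights can be cancelled.\<close>

lemma AE_dunkl_measure_nonzero: "AE x in dunkl_measure k. x \<noteq> 0"
  unfolding dunkl_measure_def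
  by (subst AE_density, measurable) (rule AE_mp[OF AE_lborel_singleton[of 0]], simp)

text \<open>The density raises the exponent to \<open>\<gamma> + 2 * k + 1\<close>, and the
  hypothesis on \<open>\<gamma>\<close> says that this exceeds -1, which is integrability at the
  origin.\<close>

lemma nn_integral_dunkl_abs_powr:
  assumes "k > -1" "\<gamma> > - 2 * (k + 1)" "r \<ge> 0"
  shows "(\<integral>\<^sup>+ x. ennreal (\<bar>x\<bar> powr \<gamma>) * indicator {-r..r} x \<partial>dunkl_measure k)
    = ennreal (2 * r powr (\<gamma> + 2 * (k + 1)) / (dunkl_const k * (\<gamma> + 2 * (k + 1))))"
proof -
  have c: "dunkl_const k > 0" using assms by (intro dunkl_const_pos)
  have "(\<integral>\<^sup>+ x. ennreal (\<bar>x\<bar> powr \<gamma>) * indicator {-r..r} x \<partial>dunkl_measure k)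
      = (\<integral>\<^sup>+ x. ennreal (\<bar>x\<bar> powr (2 * k + 1) / dunkl_const k)
          * (ennreal (\<bar>x\<bar> powr \<gamma>) * indicator {-r..r} x) \<partial>lborel)"
    unfolding dunkl_measure_def dunkl_const_def by (subst nn_integral_density) auto
  also have "\<dots> = (\<integral>\<^sup>+ x. ennreal (1 / dunkl_const k)
      * (ennreal (\<bar>x\<bar> powr (\<gamma> + 2 * k + 1)) * indicator {-r..r} x) \<partial>lborel)"
  proof (intro nn_integral_cong)
    fix x :: real
    have "\<bar>x\<bar> powr (2 * k + 1) * \<bar>x\<bar> powr \<gamma> = \<bar>x\<bar> powr (\<gamma> + 2 * k + 1)"
      by (simp add: powr_add[symmetric] algebra_simps)
    then show "ennreal (\<bar>x\<bar> powr (2 * k + 1) / dunkl_const k)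
          * (ennreal (\<bar>x\<bar> powr \<gamma>) * indicator {-r..r} x)
        = ennreal (1 / dunkl_const k)
          * (ennreal (\<bar>x\<bar> powr (\<gamma> + 2 * k + 1)) * indicator {-r..r} x)"
      using c by (cases "x \<in> {-r..r}") (auto simp: ennreal_mult[symmetric])
  qed
  also have "\<dots> = ennreal (1 / dunkl_const k)
      * ennreal (2 * r powr (\<gamma> + 2 * k + 1 + 1) / (\<gamma> + 2 * k + 1 + 1))"
    using assms by (subst nn_integral_cmult)
      (auto simp: nn_integral_has_integral_lebesgue'[OF _ has_integral_abs_powr])
  also have "\<dots> = ennreal (2 * r powr (\<gamma> + 2 * (k + 1)) / (dunkl_const k * (\<gamma> + 2 * (k + 1))))"
    using c assms by (subst ennreal_mult[symmetric]) (auto simp: add_ac distrib_left)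
  finally show ?thesis .
qed

lemma emeasure_dunkl_interval:
  assumes "k > -1" "r \<ge> 0"
  shows "emeasure (dunkl_measure k) {-r..r} = ennreal (r powr (2 * (k + 1)) / (dunkl_const k * (k + 1)))"
proof -
  have "emeasure (dunkl_measure k) {-r..r} = (\<integral>\<^sup>+ x. indicator {-r..r} x \<partial>dunkl_measure k)"
    by simp
  \<comment> \<open>Equality holds only almost everywhere, because
    \<open>0 powr 0 = 0\<close>.\<close>
  also have "\<dots> = (\<integral>\<^sup>+ x. ennreal (\<bar>x\<bar> powr 0) * indicator {-r..r} x \<partial>dunkl_measure k)"
    by (rule nn_integral_cong_AE, rule AE_mp[OF AE_dunkl_measure_nonzero]) simp
  also have "\<dots> = ennreal (r powr (2 * (k + 1)) / (dunkl_const k * (k + 1)))"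
    using assms dunkl_const_pos[of k]
    by (subst nn_integral_dunkl_abs_powr) (auto simp: divide_simps intro!: arg_cong[where f = ennreal])
  finally show ?thesis .
qed

section \<open>Supremum bound for the transform and the two pieces of a weighted function\<close>

lemma norm_lc_dunkl_le:
  assumes "k \<ge> - 1 / 2"
  shows "ennreal (cmod (lc_dunkl k M f l))
    \<le> ennreal (cmod (1 / (\<i> * of_real (M $ 1 $ 2)) powr of_real (k + 1)))
      * (\<integral>\<^sup>+ x. ennreal (cmod (f x)) \<partial>dunkl_measure k)"
proof -
  define F where "F = (\<lambda>x. f x * exp (\<i> / 2 * of_real (M $ 2 $ 2 / M $ 1 $ 2 * l\<^sup>2
      + M $ 1 $ 1 / M $ 1 $ 2 * x\<^sup>2)) * dunkl_kernel k (l / M $ 1 $ 2) x)"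
  have "cmod (exp (\<i> / 2 * of_real t)) = 1" for t
    by (simp add: norm_exp_eq_Re)
  then have "cmod (F x) \<le> cmod (f x)" for x
    using norm_dunkl_kernel_le_1[OF assms] by (simp add: F_def norm_mult mult_left_le)
  then have F: "(\<integral>\<^sup>+ x. ennreal (cmod (F x)) \<partial>dunkl_measure k)
      \<le> (\<integral>\<^sup>+ x. ennreal (cmod (f x)) \<partial>dunkl_measure k)"
    by (intro nn_integral_mono) simp
  have "ennreal (cmod (LINT x|dunkl_measure k. F x))
      \<le> (\<integral>\<^sup>+ x. ennreal (cmod (F x)) \<partial>dunkl_measure k)"
    \<comment> \<open>Without integrability the Bochner integral is zero by default and the bound is
      trivial.\<close>
    by (cases "integrable (dunkl_measure k) F")
      (auto intro: integral_norm_bound_ennreal simp: not_integrable_integral_eq)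
  also note F
  finally show ?thesis
    unfolding lc_dunkl_def Let_def F_def[symmetric] norm_mult
    by (subst ennreal_mult) (simp_all only: norm_ge_zero mult_left_mono zero_le)
qed

text \<open>Hoelder's inequality for \<open>\<bar>x\<bar> powr \<alpha> * cmod (f x)\<close> and
  \<open>\<bar>x\<bar> powr (-\<alpha>)\<close> on the interval; \<open>?W\<close> is the integral
  of the \<open>q\<close>-th power of the second factor.\<close>

lemma nn_integral_near_le:
  assumes "k > -1" "p > 1" "1 / p + 1 / q = 1" "\<alpha> * q < 2 * (k + 1)" "r > 0" "A > 0"
    and [measurable]: "f \<in> borel_measurable (dunkl_measure k)"
    and A: "Lp_norm k p (\<lambda>y. of_real (\<bar>y\<bar> powr \<alpha>) * f y) \<le> ennreal A"
  shows "(\<integral>\<^sup>+ x. ennreal (cmod (indicator {-r..r} x * f x)) \<partial>dunkl_measure k)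
    \<le> ennreal (A * (2 * r powr (2 * (k + 1) - \<alpha> * q)
        / (dunkl_const k * (2 * (k + 1) - \<alpha> * q))) powr (1 / q))"
    (is "_ \<le> ennreal (A * ?W powr (1 / q))")
proof -
  have q: "q > 1" by (rule conjugate_exponent_gt_1[OF assms(2,3)])
  have W: "?W > 0" using assms dunkl_const_pos[of k] by simp
  have "(\<integral>\<^sup>+ x. ennreal (cmod (indicator {-r..r} x * f x)) \<partial>dunkl_measure k)
      = (\<integral>\<^sup>+ x. ennreal ((\<bar>x\<bar> powr \<alpha> * cmod (f x)) * (\<bar>x\<bar> powr (-\<alpha>) * indicator {-r..r} x))
          \<partial>dunkl_measure k)"
    by (rule nn_integral_cong_AE, rule AE_mp[OF AE_dunkl_measure_nonzero])
      (auto simp: norm_mult powr_minus field_simps split: split_indicator)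
  also have "\<dots> \<le> ennreal (A * ?W powr (1 / q))"
  proof (rule nn_integral_Holder)
    show "(\<integral>\<^sup>+ x. ennreal ((\<bar>x\<bar> powr \<alpha> * cmod (f x)) powr p) \<partial>dunkl_measure k)
        \<le> ennreal (A powr p)"
      using A assms by (subst (asm) Lp_norm_le_iff) (auto simp: norm_mult)
    have "(\<integral>\<^sup>+ x. ennreal ((\<bar>x\<bar> powr (-\<alpha>) * indicator {-r..r} x) powr q) \<partial>dunkl_measure k)
        = (\<integral>\<^sup>+ x. ennreal (\<bar>x\<bar> powr (- \<alpha> * q)) * indicator {-r..r} x \<partial>dunkl_measure k)"
      by (intro nn_integral_cong) (auto simp: powr_powr split: split_indicator)
    also have "\<dots> = ennreal ?W"
      using assms by (subst nn_integral_dunkl_abs_powr) (auto simp: algebra_simps)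
    also have "?W = (?W powr (1 / q)) powr q"
    proof -
      have "x = (x powr (1 / q)) powr q" if "x > 0" for x :: real
        using that q by (simp add: powr_powr)
      then show ?thesis using W .
    qed
    finally show "(\<integral>\<^sup>+ x. ennreal ((\<bar>x\<bar> powr (-\<alpha>) * indicator {-r..r} x) powr q)
        \<partial>dunkl_measure k) \<le> ennreal ((?W powr (1 / q)) powr q)" by (rule eq_refl)
    show "?W powr (1 / q) > 0" using W by (metis powr_gt_zero less_irrefl)
  qed (use assms q in auto)
  finally show ?thesis .
qed

text \<open>A Chebyshev-type estimate: outside the interval the weight is at least
  \<open>r powr \<gamma>\<close>. It serves twice, for \<open>f\<close> with weight exponent
  \<alpha> and for \<open>D f\<close> with weight exponent \<beta>.\<close>

lemma nn_integral_far_le: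
  assumes "p > 0" "\<gamma> > 0" "r > 0" "Z \<ge> 0"
    and [measurable]: "f \<in> borel_measurable (dunkl_measure k)"
    and Z: "Lp_norm k p (\<lambda>y. of_real (\<bar>y\<bar> powr \<gamma>) * f y) \<le> ennreal Z"
  shows "(\<integral>\<^sup>+ x. ennreal (cmod (f x) powr p) * indicator (- {-r..r}) x \<partial>dunkl_measure k)
    \<le> ennreal ((r powr (- \<gamma>) * Z) powr p)"
proof -
  have "(\<integral>\<^sup>+ x. ennreal (cmod (f x) powr p) * indicator (- {-r..r}) x \<partial>dunkl_measure k)
      \<le> (\<integral>\<^sup>+ x. ennreal ((r powr (- \<gamma>)) powr p)
          * ennreal (cmod (of_real (\<bar>x\<bar> powr \<gamma>) * f x) powr p) \<partial>dunkl_measure k)"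
  proof (intro nn_integral_mono)
    fix x :: real
    have "cmod (f x) \<le> r powr (- \<gamma>) * (\<bar>x\<bar> powr \<gamma> * cmod (f x))" if "x \<notin> {-r..r}"
    proof -
      have "1 = r powr (- \<gamma>) * r powr \<gamma>" using assms by (simp add: powr_minus)
      also have "\<dots> \<le> r powr (- \<gamma>) * \<bar>x\<bar> powr \<gamma>"
        using that assms by (intro mult_left_mono powr_mono2) auto
      finally show ?thesis
        using mult_right_mono[of 1 "r powr (- \<gamma>) * \<bar>x\<bar> powr \<gamma>" "cmod (f x)"]
        by (simp add: mult.assoc)
    qed
    then have "cmod (f x) powr p \<le> (r powr (- \<gamma>) * (\<bar>x\<bar> powr \<gamma> * cmod (f x))) powr p"
      if "x \<notin> {-r..r}" using that assms by (intro powr_mono2) auto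
    then show "ennreal (cmod (f x) powr p) * indicator (- {-r..r}) x
        \<le> ennreal ((r powr (- \<gamma>)) powr p) * ennreal (cmod (of_real (\<bar>x\<bar> powr \<gamma>) * f x) powr p)"
      by (cases "x \<in> {-r..r}") (auto simp: norm_mult powr_mult ennreal_mult[symmetric])
  qed
  also have "\<dots> = ennreal ((r powr (- \<gamma>)) powr p)
      * (\<integral>\<^sup>+ x. ennreal (cmod (of_real (\<bar>x\<bar> powr \<gamma>) * f x) powr p) \<partial>dunkl_measure k)"
    by (rule nn_integral_cmult) measurable
  also have "\<dots> \<le> ennreal ((r powr (- \<gamma>)) powr p) * ennreal (Z powr p)"
    using Z assms by (intro mult_left_mono) (auto simp: Lp_norm_le_iff)
  also have "\<dots> = ennreal ((r powr (- \<gamma>) * Z) powr p)"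
    using assms by (simp add: powr_mult ennreal_mult)
  finally show ?thesis .
qed

section \<open>The transform at low frequencies\<close>

text \<open>The sum is at most twice the maximum. The crude factor only enters the constant of the
  final inequality.\<close>

lemma powr_add_le:
  fixes x y q :: real
  assumes "x \<ge> 0" "y \<ge> 0" "q > 0"
  shows "(x + y) powr q \<le> 2 powr q * (x powr q + y powr q)"
proof -
  have "(x + y) powr q \<le> (2 * max x y) powr q"
    using assms by (intro powr_mono2) auto
  also have "\<dots> = 2 powr q * max x y powr q"
    using assms by (simp add: powr_mult)
  also have "max x y powr q \<le> x powr q + y powr q"
    by (simp add: max_def)
  finally show ?thesis by simp
qed

lemma Lp_space_iff:
  assumes "p > 0"
  shows "f \<in> Lp_space k p \<longleftrightarrow> f \<in> borel_measurable (dunkl_measure k) \<and>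
    (\<integral>\<^sup>+ x. ennreal (cmod (f x) powr p) \<partial>dunkl_measure k) < top"
  using assms by (auto simp: Lp_space_def Lp_norm_def epowr_def top.not_eq_extremum)

lemma Lp_space_indicator_mult:
  assumes "p > 0" "f \<in> Lp_space k p" "S \<in> sets borel"
  shows "(\<lambda>x. indicator S x * f x) \<in> Lp_space k p"
proof -
  have [measurable]: "f \<in> borel_measurable (dunkl_measure k)" "S \<in> sets borel"
    using assms by (auto simp: Lp_space_def)
  have "(\<integral>\<^sup>+ x. ennreal (cmod (indicator S x * f x) powr p) \<partial>dunkl_measure k)
      \<le> (\<integral>\<^sup>+ x. ennreal (cmod (f x) powr p) \<partial>dunkl_measure k)"
    by (intro nn_integral_mono) (auto split: split_indicator)
  then show ?thesis using assms by (auto simp: Lp_space_iff intro: le_less_trans)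
qed

text \<open>\<open>E\<close> is chosen before \<open>f\<close>, \<open>A\<close> and
  \<open>s\<close>, which leaves the cutoff \<open>s\<close> free to depend on \<open>f\<close> in
  the final balancing.\<close>

lemma low_frequency_bound:
  assumes k: "k \<ge> - 1 / 2" and p: "p > 1" and pq: "1 / p + 1 / q = 1"
    and \<alpha>: "\<alpha> > 0" "\<alpha> * q < 2 * (k + 1)"
    and D: "is_lc_dunkl_extension k M p q D"
  shows "\<exists>E>0. \<forall>f\<in>Lp_space k p. \<forall>A>0. \<forall>s>0.
    Lp_norm k p (\<lambda>y. of_real (\<bar>y\<bar> powr \<alpha>) * f y) \<le> ennreal A \<longrightarrow>
    (\<integral>\<^sup>+ l. ennreal (cmod (D f l) powr q) * indicator {-s..s} l \<partial>dunkl_measure k)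
      \<le> ennreal (E * (s powr \<alpha> * A) powr q)"
proof -
  have q: "q > 1" using p pq by (rule conjugate_exponent_gt_1)
  have c: "dunkl_const k > 0" using k by (intro dunkl_const_pos) auto
  obtain B where B: "\<And>f. f \<in> Lp_space k p \<Longrightarrow> Lp_norm k q (D f) \<le> ennreal B * Lp_norm k p f"
    using D unfolding is_lc_dunkl_extension_def by blast
  \<comment> \<open>The bound \<open>B\<close> may be zero or negative; \<open>B'\<close> is a
    positive replacement.\<close>
  define B' where "B' = max B 1"
  define K where "K = cmod (1 / (\<i> * of_real (M $ 1 $ 2)) powr of_real (k + 1))"
  \<comment> \<open>\<open>v\<close> is the denominator in the measure of \<open>{-s..s}\<close>,
    and \<open>w\<close> the one in the integral of the singular weight over
    \<open>{-r..r}\<close>.\<close>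
  define v w where "v = dunkl_const k * (k + 1)"
    and "w = dunkl_const k * (2 * (k + 1) - \<alpha> * q) / 2"
  have pos: "v > 0" "w > 0" "K \<ge> 0" "B' > 0"
    using c k \<alpha> by (auto simp: v_def w_def K_def B'_def)
  \<comment> \<open>The summands come from the inner and the outer part of \<open>f\<close>, the
    factor \<open>2 powr q\<close> from \<open>powr_add_le\<close>.\<close>
  define E where "E = 2 powr q * (K powr q / (v * w) + B' powr q)"
  have "E > 0" unfolding E_def using pos by (intro mult_pos_pos add_nonneg_pos) auto
  moreover have "(\<integral>\<^sup>+ l. ennreal (cmod (D f l) powr q) * indicator {-s..s} l \<partial>dunkl_measure k)
      \<le> ennreal (E * (s powr \<alpha> * A) powr q)"
    if f: "f \<in> Lp_space k p" and A: "A > 0" and s: "s > 0"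
      and fA: "Lp_norm k p (\<lambda>y. of_real (\<bar>y\<bar> powr \<alpha>) * f y) \<le> ennreal A" for f A s
  proof -
    \<comment> \<open>The reciprocal radius makes both parts scale alike, as
      \<open>s powr \<alpha>\<close>.\<close>
    define r where "r = 1 / s"
    have r: "r > 0" using s by (simp add: r_def)
    define g h where "g = (\<lambda>x. indicator {-r..r} x * f x)"
      and "h = (\<lambda>x. indicator (- {-r..r}) x * f x)"
    have [measurable]: "f \<in> borel_measurable (dunkl_measure k)" using f by (simp add: Lp_space_def)
    have gp: "g \<in> Lp_space k p" and hp: "h \<in> Lp_space k p"
      unfolding g_def h_def using f p by (auto intro!: Lp_space_indicator_mult)
    have [measurable]: "D g \<in> borel_measurable (dunkl_measure k)"
        "D h \<in> borel_measurable (dunkl_measure k)"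
      using D gp hp by (auto simp: is_lc_dunkl_extension_def Lp_space_def)
    have gh: "(\<lambda>x. g x + h x) = f"
      by (auto simp: g_def h_def fun_eq_iff split: split_indicator)
    have "AE l in dunkl_measure k. D (\<lambda>x. g x + h x) l = D g l + D h l"
      using D gp hp unfolding is_lc_dunkl_extension_def by blast
    then have Dsum: "AE l in dunkl_measure k. D f l = D g l + D h l"
      unfolding gh .
    define G where "G = A * (r powr (2 * (k + 1) - \<alpha> * q) / w) powr (1 / q)"
    have "G \<ge> 0" using A by (simp add: G_def)
    have g1: "(\<integral>\<^sup>+ x. ennreal (cmod (g x)) \<partial>dunkl_measure k) \<le> ennreal G"
      using nn_integral_near_le[OF _ p pq \<alpha>(2) r A _ fA] k
      by (simp add: g_def G_def w_def mult.commute)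
    then have "g \<in> Lp_space k 1"
      using gp p by (auto simp: Lp_space_iff intro: le_less_trans)
    \<comment> \<open>Only the inner part is known to lie in L^1, so only there is the integral
      formula used; for \<open>h\<close> the operator bound has to do.\<close>
    then have "AE l in dunkl_measure k. D g l = lc_dunkl k M g l"
      using D gp unfolding is_lc_dunkl_extension_def by blast
    moreover have "cmod (lc_dunkl k M g l) \<le> K * G" for l
    proof -
      have "ennreal (cmod (lc_dunkl k M g l)) \<le> ennreal K * ennreal G"
        using norm_lc_dunkl_le[OF k, of M g l] mult_left_mono[OF g1, of "ennreal K"]
        unfolding K_def by (meson order_trans zero_le)
      then show ?thesis using pos \<open>G \<ge> 0\<close> by (simp add: ennreal_mult[symmetric])
    qed
    ultimately have Dg: "AE l in dunkl_measure k. cmod (D g l) \<le> K * G" by auto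
    have "(\<integral>\<^sup>+ l. ennreal (cmod (D g l) powr q) * indicator {-s..s} l \<partial>dunkl_measure k)
        \<le> (\<integral>\<^sup>+ l. ennreal ((K * G) powr q) * indicator {-s..s} l \<partial>dunkl_measure k)"
      by (rule nn_integral_mono_AE, rule AE_mp[OF Dg])
        (use q in \<open>auto intro!: mult_right_mono powr_mono2 ennreal_leI\<close>)
    also have "\<dots> = ennreal ((K * G) powr q) * ennreal (s powr (2 * (k + 1)) / v)"
      using k s by (subst nn_integral_cmult_indicator) (auto simp: emeasure_dunkl_interval v_def)
    also have "\<dots> = ennreal (K powr q / (v * w) * (s powr \<alpha> * A) powr q)"
    proof -
      \<comment> \<open>The volume growth of the frequency interval cancels against the decay in
        \<open>r\<close>, leaving only the power coming from the weight.\<close>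
      have sr: "s powr (2 * (k + 1)) * r powr (2 * (k + 1) - \<alpha> * q) = (s powr \<alpha>) powr q"
        using s by (simp add: r_def powr_divide powr_diff powr_powr field_simps)
      have "(K * G) powr q = K powr q * (A powr q * (r powr (2 * (k + 1) - \<alpha> * q) / w))"
        using pos A q by (simp add: G_def powr_mult powr_powr)
      then have "(K * G) powr q * (s powr (2 * (k + 1)) / v) = K powr q / (v * w)
          * ((s powr (2 * (k + 1)) * r powr (2 * (k + 1) - \<alpha> * q)) * A powr q)"
        by (simp add: mult_ac)
      also have "\<dots> = K powr q / (v * w) * (s powr \<alpha> * A) powr q"
        unfolding sr using A by (simp add: powr_mult)
      finally show ?thesis using pos by (simp add: ennreal_mult[symmetric])
    qed
    finally have I1: "(\<integral>\<^sup>+ l. ennreal (cmod (D g l) powr q) * indicator {-s..s} l \<partial>dunkl_measure k)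
        \<le> ennreal (K powr q / (v * w) * (s powr \<alpha> * A) powr q)" .
    have "(\<integral>\<^sup>+ x. ennreal (cmod (h x) powr p) \<partial>dunkl_measure k)
        = (\<integral>\<^sup>+ x. ennreal (cmod (f x) powr p) * indicator (- {-r..r}) x \<partial>dunkl_measure k)"
      by (intro nn_integral_cong) (auto simp: h_def split: split_indicator)
    also have "\<dots> \<le> ennreal ((r powr (- \<alpha>) * A) powr p)"
      using nn_integral_far_le[OF _ \<alpha>(1) r _ _ fA] p A by auto
    finally have "Lp_norm k p h \<le> ennreal (r powr (- \<alpha>) * A)"
      using p A by (simp add: Lp_norm_le_iff)
    then have "Lp_norm k q (D h) \<le> ennreal B' * ennreal (r powr (- \<alpha>) * A)"
      by (intro order_trans[OF B[OF hp]] mult_mono) (auto simp: B'_def ennreal_leI)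
    also have "\<dots> = ennreal (B' * (s powr \<alpha> * A))"
      using pos A s by (simp add: ennreal_mult[symmetric] r_def powr_divide powr_minus)
    finally have I2: "(\<integral>\<^sup>+ l. ennreal (cmod (D h l) powr q) \<partial>dunkl_measure k)
        \<le> ennreal (B' powr q * (s powr \<alpha> * A) powr q)"
      using q A pos by (simp add: Lp_norm_le_iff powr_mult)
    have "(\<integral>\<^sup>+ l. ennreal (cmod (D f l) powr q) * indicator {-s..s} l \<partial>dunkl_measure k)
        \<le> (\<integral>\<^sup>+ l. ennreal (2 powr q) * (ennreal (cmod (D g l) powr q) * indicator {-s..s} l
            + ennreal (cmod (D h l) powr q)) \<partial>dunkl_measure k)"
    proof (rule nn_integral_mono_AE, rule AE_mp[OF Dsum], intro AE_I2 impI)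
      fix l assume "D f l = D g l + D h l"
      then have "cmod (D f l) powr q \<le> (cmod (D g l) + cmod (D h l)) powr q"
        using q norm_triangle_ineq[of "D g l" "D h l"] by (intro powr_mono2) auto
      also have "\<dots> \<le> 2 powr q * (cmod (D g l) powr q + cmod (D h l) powr q)"
        using q by (intro powr_add_le) auto
      finally show "ennreal (cmod (D f l) powr q) * indicator {-s..s} l
          \<le> ennreal (2 powr q) * (ennreal (cmod (D g l) powr q) * indicator {-s..s} l
            + ennreal (cmod (D h l) powr q))"
        by (cases "l \<in> {-s..s}")
          (auto simp: ennreal_mult[symmetric] ennreal_plus[symmetric] simp del: ennreal_plus)
    qed
    also have "\<dots> = ennreal (2 powr q) *
        ((\<integral>\<^sup>+ l. ennreal (cmod (D g l) powr q) * indicator {-s..s} l \<partial>dunkl_measure k)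
          + (\<integral>\<^sup>+ l. ennreal (cmod (D h l) powr q) \<partial>dunkl_measure k))"
      by (simp add: nn_integral_cmult nn_integral_add)
    also have "\<dots> \<le> ennreal (2 powr q) * (ennreal (K powr q / (v * w) * (s powr \<alpha> * A) powr q)
        + ennreal (B' powr q * (s powr \<alpha> * A) powr q))"
      by (intro mult_left_mono add_mono I1 I2) auto
    also have "\<dots> = ennreal (E * (s powr \<alpha> * A) powr q)"
    proof -
      define Y where "Y = (s powr \<alpha> * A) powr q"
      have "Y \<ge> 0" by (simp add: Y_def)
      then show ?thesis
        using pos unfolding E_def Y_def[symmetric]
        by (simp add: ennreal_plus[symmetric] ennreal_mult[symmetric] distrib_right mult.assoc
            del: ennreal_plus)
    qed
    finally show ?thesis .
  qed
  ultimately show ?thesis by blast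
qed

section \<open>Balancing low and high frequencies\<close>

theorem theorem3p1:
  fixes k p q \<alpha> \<beta> :: real
    and M :: "real^2^2"
    and D :: "(real \<Rightarrow> complex) \<Rightarrow> (real \<Rightarrow> complex)"
  assumes "k \<ge> - 1 / 2"
    and "det M = 1" and "M $ 1 $ 2 \<noteq> 0"
    and "1 < p" and "p \<le> 2" and "1 / p + 1 / q = 1"
    and "0 < \<alpha>" and "\<alpha> < 2 * (k + 1) / q" and "\<beta> > 0"
    and "is_lc_dunkl_extension k M p q D"
  shows "\<exists>C::real. C > 0 \<and> (\<forall>f\<in>Lp_space k p.
           Lp_norm k q (D f)
             \<le> ennreal C
               * epowr (Lp_norm k p (\<lambda>y. of_real (\<bar>y\<bar> powr \<alpha>) * f y)) (\<beta> / (\<alpha> + \<beta>))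
               * epowr (Lp_norm k q (\<lambda>l. of_real (\<bar>l\<bar> powr \<beta>) * D f l)) (\<alpha> / (\<alpha> + \<beta>)))"
proof -
  note p = \<open>1 < p\<close> and D = \<open>is_lc_dunkl_extension k M p q D\<close>
  have q: "q > 1" using p \<open>1 / p + 1 / q = 1\<close> by (rule conjugate_exponent_gt_1)
  have \<alpha>q: "\<alpha> * q < 2 * (k + 1)" using assms q by (simp add: field_simps)
  obtain E where E: "E > 0" and low: "\<And>f A s. \<lbrakk>f \<in> Lp_space k p; A > 0; s > 0;
      Lp_norm k p (\<lambda>y. of_real (\<bar>y\<bar> powr \<alpha>) * f y) \<le> ennreal A\<rbrakk> \<Longrightarrow>
      (\<integral>\<^sup>+ l. ennreal (cmod (D f l) powr q) * indicator {-s..s} l \<partial>dunkl_measure k)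
        \<le> ennreal (E * (s powr \<alpha> * A) powr q)"
    using low_frequency_bound[OF assms(1) p assms(6,7) \<alpha>q D] by blast
  \<comment> \<open>In \<open>E + 1\<close>, the term \<open>E\<close> accounts for low frequencies
    and 1 for high ones.\<close>
  define C where "C = (E + 1) powr (1 / q)"
  have C: "C > 0" "C powr q = E + 1" using E q by (auto simp: C_def powr_powr)
  show ?thesis
  proof (intro exI[of _ C] conjI ballI)
    fix f assume f: "f \<in> Lp_space k p"
    then have Df: "D f \<in> Lp_space k q" using D by (auto simp: is_lc_dunkl_extension_def)
    have [measurable]: "f \<in> borel_measurable (dunkl_measure k)"
        "D f \<in> borel_measurable (dunkl_measure k)"
      using f Df by (auto simp: Lp_space_def)
    define NA NZ where "NA = Lp_norm k p (\<lambda>y. of_real (\<bar>y\<bar> powr \<alpha>) * f y)"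
      and "NZ = Lp_norm k q (\<lambda>l. of_real (\<bar>l\<bar> powr \<beta>) * D f l)"
    \<comment> \<open>A balancing cutoff needs both weighted norms positive and finite. The zero
      case comes before the infinite one because \<open>0 * top = 0\<close> in
      \<open>ennreal\<close>.\<close>
    consider (zero) "NA = 0 \<or> NZ = 0" | (infinite) "NA \<noteq> 0" "NZ \<noteq> 0" "NA = top \<or> NZ = top"
      | (finite) A Z where "NA = ennreal A" "NZ = ennreal Z" "A > 0" "Z > 0"
      by (cases NA; cases NZ) force+
    then show "Lp_norm k q (D f) \<le> ennreal C * epowr NA (\<beta> / (\<alpha> + \<beta>)) * epowr NZ (\<alpha> / (\<alpha> + \<beta>))"
    proof cases
      case zero
      have "Lp_norm k q (D f) = 0"
        using zero
      proof
        assume "NA = 0"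
        then have "AE y in dunkl_measure k. of_real (\<bar>y\<bar> powr \<alpha>) * f y = 0"
          using p unfolding NA_def by (subst (asm) Lp_norm_eq_0_iff) auto
        with AE_dunkl_measure_nonzero have "AE y in dunkl_measure k. f y = 0"
          by eventually_elim auto
        then have "Lp_norm k p f = 0" using p by (subst Lp_norm_eq_0_iff) auto
        \<comment> \<open>The operator bound carries the vanishing norm of \<open>f\<close> over to
          \<open>D f\<close>.\<close>
        then show ?thesis using D f unfolding is_lc_dunkl_extension_def
          by (metis le_zero_eq mult_zero_right)
      next
        assume "NZ = 0"
        then have "AE l in dunkl_measure k. of_real (\<bar>l\<bar> powr \<beta>) * D f l = 0"
          using q unfolding NZ_def by (subst (asm) Lp_norm_eq_0_iff) auto
        with AE_dunkl_measure_nonzero have "AE l in dunkl_measure k. D f l = 0"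
          by eventually_elim auto
        then show ?thesis using q by (subst Lp_norm_eq_0_iff) auto
      qed
      then show ?thesis by simp
    next
      case infinite
      have "epowr x r \<noteq> 0" if "x \<noteq> 0" for x r
        using that by (cases x) (auto simp: epowr_def ennreal_eq_0_iff)
      then have "ennreal C * epowr NA (\<beta> / (\<alpha> + \<beta>)) * epowr NZ (\<alpha> / (\<alpha> + \<beta>)) = top"
        using infinite C by (auto simp: epowr_def[of top] ennreal_mult_eq_top_iff)
      then show ?thesis by simp
    next
      case (finite A Z)
      \<comment> \<open>The solution of \<open>s powr \<alpha> * A = s powr (- \<beta>) * Z\<close>;
        the common value of the two sides is \<open>X\<close>.\<close>
      define s where "s = (Z / A) powr (1 / (\<alpha> + \<beta>))"
      define X where "X = A powr (\<beta> / (\<alpha> + \<beta>)) * Z powr (\<alpha> / (\<alpha> + \<beta>))"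
      have s: "s > 0" and X: "X > 0" using finite by (auto simp: s_def X_def)
      have e: "\<beta> / (\<alpha> + \<beta>) = 1 - \<alpha> / (\<alpha> + \<beta>)" "\<alpha> / (\<alpha> + \<beta>) = 1 - \<beta> / (\<alpha> + \<beta>)"
        using assms by (auto simp: field_simps)
      have sA: "s powr \<alpha> * A = X"
      proof -
        have "s powr \<alpha> * A = Z powr (\<alpha> / (\<alpha> + \<beta>)) * A powr (1 - \<alpha> / (\<alpha> + \<beta>))"
          using finite by (simp add: s_def powr_powr powr_divide powr_diff)
        then show ?thesis by (simp add: X_def flip: e(1))
      qed
      have sZ: "s powr (- \<beta>) * Z = X"
      proof -
        have "s powr (- \<beta>) * Z = A powr (\<beta> / (\<alpha> + \<beta>)) * Z powr (1 - \<beta> / (\<alpha> + \<beta>))"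
          using finite by (simp add: s_def powr_powr powr_divide powr_diff powr_minus)
        then show ?thesis by (simp add: X_def flip: e(2))
      qed
      have "(\<integral>\<^sup>+ l. ennreal (cmod (D f l) powr q) \<partial>dunkl_measure k)
          = (\<integral>\<^sup>+ l. ennreal (cmod (D f l) powr q) * indicator {-s..s} l
              + ennreal (cmod (D f l) powr q) * indicator (- {-s..s}) l \<partial>dunkl_measure k)"
        by (intro nn_integral_cong) (auto split: split_indicator)
      also have "\<dots> = (\<integral>\<^sup>+ l. ennreal (cmod (D f l) powr q) * indicator {-s..s} l \<partial>dunkl_measure k)
          + (\<integral>\<^sup>+ l. ennreal (cmod (D f l) powr q) * indicator (- {-s..s}) l \<partial>dunkl_measure k)"
        by (rule nn_integral_add) measurable
      also have "\<dots> \<le> ennreal (E * X powr q) + ennreal (X powr q)"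
        using low[OF f finite(3) s] nn_integral_far_le[of q \<beta> s Z "D f" k] finite s q assms
        by (intro add_mono) (auto simp: NA_def NZ_def sA sZ)
      also have "\<dots> = ennreal ((C * X) powr q)"
        using C E X by (simp add: powr_mult algebra_simps flip: ennreal_plus)
      finally have "Lp_norm k q (D f) \<le> ennreal (C * X)"
        using C X q by (simp add: Lp_norm_le_iff)
      then show ?thesis
        using C finite by (simp add: epowr_ennreal X_def ennreal_mult mult.assoc)
    qed
  qed (use C in simp)
qed

end
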